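(* Let $\kappa$ be an uncountable regular cardinal and let $\mathbb{B}$ be a $\kappa$-Corson Boolean algebra. Then $\langle \mathbb{B}, \tau_p\rangle$ is $\kappa$-Lindelöf. In particular, if $\kappa = \lambda^+$, then the Lindelöf number of $\langle \mathbb{B}, \tau_p\rangle$ does not exceed $\lambda$.
   Context: A Boolean algebra $\mathbb{B}$ is $\kappa$-Corson if there is a set $G \subseteq \mathbb{B}$ generating $\mathbb{B}$ as a Boolean algebra such that $|G \cap p| < \kappa$ for every $p \in \mathrm{Ult}(\mathbb{B})$, where $\mathrm{Ult}(\mathbb{B})$ is the set of ultrafilters of $\mathbb{B}$. The pointwise topology $\tau_p$ on $\mathbb{B}$ is the topology with subbase consisting of the sets $V_q^+ = \{a \in \mathbb{B} : a \in q\}$ and $V_q^- = \{a \in \mathbb{B} : a \notin q\}$ for $q \in \mathrm{Ult}(\mathbb{B})$. A topological space is $\kappa$-Lindelöf if every open cover of it contains a subcover of cardinality $< \kappa$. The Lindelöf number of a space is the least infinite cardinal $\mu$ such that every open cover has a subcover of cardinality $\leq \mu$. *)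

theory Defs
  imports "HOL-Analysis.Analysis"
begin

unbundle cardinal_syntax
no_notation elt_set_eq (infix "=o" 50)

text \<open>
  Cardinals are cardinal orders in the sense of \<open>Card_order\<close>, on arbitrary types, compared by
  \<open>\<le>o\<close>, \<open><o\<close>, \<open>=o\<close>; equality of cardinals is \<open>=o\<close>.
\<close>

definition boolean_subalgebra :: "'a::boolean_algebra set \<Rightarrow> bool" where
  "boolean_subalgebra S \<longleftrightarrow>
     bot \<in> S \<and> top \<in> S \<and>
     (\<forall>a\<in>S. \<forall>b\<in>S. inf a b \<in> S) \<and> (\<forall>a\<in>S. \<forall>b\<in>S. sup a b \<in> S) \<and> (\<forall>a\<in>S. - a \<in> S)"

definition generates_boolean_algebra :: "'a::boolean_algebra set \<Rightarrow> bool" where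
  "generates_boolean_algebra G \<longleftrightarrow> boolean_subalgebra hull G = UNIV"

definition proper_filter :: "'a::boolean_algebra set \<Rightarrow> bool" where
  "proper_filter p \<longleftrightarrow>
     top \<in> p \<and> (\<forall>a\<in>p. \<forall>b\<in>p. inf a b \<in> p) \<and> (\<forall>a\<in>p. \<forall>b. a \<le> b \<longrightarrow> b \<in> p) \<and> bot \<notin> p"

definition Ult :: "'a::boolean_algebra set set" where
  "Ult = {p. proper_filter p \<and> (\<forall>q. proper_filter q \<and> p \<subseteq> q \<longrightarrow> q = p)}"

definition Corson_algebra :: "'k rel \<Rightarrow> 'a::boolean_algebra itself \<Rightarrow> bool" where
  "Corson_algebra \<kappa> _ \<longleftrightarrow>
     (\<exists>G::'a set. generates_boolean_algebra G \<and> (\<forall>p\<in>Ult. |G \<inter> p| <o \<kappa>))"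

text \<open>
  The whole space is added to the subbase because \<open>topology_generated_by\<close> takes the union of its
  argument as the underlying set; this only matters for the one-element algebra, which has no
  ultrafilters.
\<close>

definition pointwise_topology :: "'a::boolean_algebra topology" where
  "pointwise_topology = topology_generated_by
     (insert UNIV ((\<lambda>q. {a. a \<in> q}) ` Ult \<union> (\<lambda>q. {a. a \<notin> q}) ` Ult))"

lemma topspace_pointwise_topology [simp]: "topspace pointwise_topology = UNIV"
  by (simp add: pointwise_topology_def)

definition card_Lindelof_space :: "'k rel \<Rightarrow> 'a topology \<Rightarrow> bool" where
  "card_Lindelof_space \<kappa> X \<longleftrightarrow>
     (\<forall>\<U>. (\<forall>U\<in>\<U>. openin X U) \<and> \<Union>\<U> = topspace X
        \<longrightarrow> (\<exists>\<V>. |\<V>| <o \<kappa> \<and> \<V> \<subseteq> \<U> \<and> \<Union>\<V> = topspace X))"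

definition Lindelof_bound :: "'a topology \<Rightarrow> 'm rel \<Rightarrow> bool" where
  "Lindelof_bound X \<mu> \<longleftrightarrow> Card_order \<mu> \<and> cinfinite \<mu> \<and>
     (\<forall>\<U>. (\<forall>U\<in>\<U>. openin X U) \<and> \<Union>\<U> = topspace X
        \<longrightarrow> (\<exists>\<V>. |\<V>| \<le>o \<mu> \<and> \<V> \<subseteq> \<U> \<and> \<Union>\<V> = topspace X))"

text \<open>
  The type \<open>nat + 'a\<close> is large enough to carry the least such cardinal. By the two lemmas
  below, the cardinal chosen exists and is least among bounds on all types, not only on this one.
\<close>

definition Lindelof_number :: "'a topology \<Rightarrow> (nat + 'a) rel" where
  "Lindelof_number X =
     (SOME \<mu>. Lindelof_bound X \<mu> \<and> (\<forall>\<nu>::(nat + 'a) rel. Lindelof_bound X \<nu> \<longrightarrow> \<mu> \<le>o \<nu>))"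

lemma Lindelof_bound_UNIV: "Lindelof_bound (X::'a topology) |UNIV::(nat + 'a) set|"
  unfolding Lindelof_bound_def
proof (intro conjI allI impI)
  show "Card_order |UNIV::(nat + 'a) set|" by (rule card_of_Card_order)
  show "cinfinite |UNIV::(nat + 'a) set|"
    by (simp add: cinfinite_def Field_card_of)
  fix \<U> :: "'a set set"
  assume \<U>: "(\<forall>U\<in>\<U>. openin X U) \<and> \<Union>\<U> = topspace X"
  then have "\<forall>x\<in>topspace X. \<exists>U. U \<in> \<U> \<and> x \<in> U" by auto
  then obtain f where f: "\<forall>x\<in>topspace X. f x \<in> \<U> \<and> x \<in> f x"
    by (rule bchoice[THEN exE])
  show "\<exists>\<V>. |\<V>| \<le>o |UNIV::(nat + 'a) set| \<and> \<V> \<subseteq> \<U> \<and> \<Union>\<V> = topspace X"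
  proof (intro exI conjI)
    have "|UNIV::'a set| \<le>o |UNIV::(nat + 'a) set|"
      using card_of_Plus2[of "UNIV::'a set" "UNIV::nat set"] by simp
    then show "|f ` topspace X| \<le>o |UNIV::(nat + 'a) set|"
      by (rule ordLeq_transitive
          [OF ordLeq_transitive[OF card_of_image card_of_mono1[OF subset_UNIV]]])
    show sub: "f ` topspace X \<subseteq> \<U>" using f by auto
    show "\<Union> (f ` topspace X) = topspace X"
    proof
      show "\<Union> (f ` topspace X) \<subseteq> topspace X"
        using Union_mono[OF sub] \<U> by simp
      show "topspace X \<subseteq> \<Union> (f ` topspace X)" using f by auto
    qed
  qed
qed

lemma Lindelof_number_least_same_type:
  fixes X :: "'a topology"
  shows "Lindelof_bound X (Lindelof_number X) \<and>
    (\<forall>\<nu>::(nat + 'a) rel. Lindelof_bound X \<nu> \<longrightarrow> Lindelof_number X \<le>o \<nu>)"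
proof -
  let ?R = "{\<mu>::(nat + 'a) rel. Lindelof_bound X \<mu>}"
  have "?R \<noteq> {}" using Lindelof_bound_UNIV[of X] by auto
  moreover have "\<forall>r\<in>?R. Card_order r" by (simp add: Lindelof_bound_def)
  ultimately have "\<exists>\<mu>\<in>?R. \<forall>\<nu>\<in>?R. \<mu> \<le>o \<nu>" by (rule exists_minim_Card_order)
  then have "\<exists>\<mu>::(nat + 'a) rel. Lindelof_bound X \<mu> \<and>
      (\<forall>\<nu>::(nat + 'a) rel. Lindelof_bound X \<nu> \<longrightarrow> \<mu> \<le>o \<nu>)"
    by (simp add: Bex_def)
  then show ?thesis unfolding Lindelof_number_def by (rule someI_ex)
qed

lemma Lindelof_bound_Lindelof_number: "Lindelof_bound X (Lindelof_number X)"
  by (rule Lindelof_number_least_same_type[THEN conjunct1])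

lemma Lindelof_number_least:
  fixes \<nu> :: "'m rel"
  assumes "Lindelof_bound X \<nu>"
  shows "Lindelof_number X \<le>o \<nu>"
proof (rule ccontr)
  have C: "Card_order \<nu>" "Card_order (Lindelof_number X)"
    using assms Lindelof_bound_Lindelof_number[of X] by (auto simp: Lindelof_bound_def)
  assume n: "\<not> Lindelof_number X \<le>o \<nu>"
  have "\<nu> \<le>o Lindelof_number X"
    using ordLeq_total[of \<nu> "Lindelof_number X"] C n by (simp add: card_order_on_def)
  from iffD1[OF internalize_ordLeq this] obtain p :: "(nat + 'a) rel" where p: "\<nu> =o p"
    by (elim exE conjE)
  have "Card_order p" by (rule Card_order_ordIso2[OF C(1) p])
  moreover have "cinfinite p"
    using assms Cinfinite_cong[OF p] by (simp add: Lindelof_bound_def)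
  moreover have "\<exists>\<V>. |\<V>| \<le>o p \<and> \<V> \<subseteq> \<U> \<and> \<Union>\<V> = topspace X"
    if \<U>: "(\<forall>U\<in>\<U>. openin X U) \<and> \<Union>\<U> = topspace X" for \<U>
  proof -
    have "\<exists>\<V>. |\<V>| \<le>o \<nu> \<and> \<V> \<subseteq> \<U> \<and> \<Union>\<V> = topspace X"
      using assms[unfolded Lindelof_bound_def, THEN conjunct2, THEN conjunct2] \<U>
      by (elim allE impE)
    then obtain \<V> where \<V>: "|\<V>| \<le>o \<nu>" "\<V> \<subseteq> \<U>" "\<Union>\<V> = topspace X"
      by (elim exE conjE)
    show ?thesis
      by (rule exI[of _ \<V>]) (simp add: \<V>(2,3) ordLeq_ordIso_trans[OF \<V>(1) p])
  qed
  ultimately have "Lindelof_bound X p" by (simp add: Lindelof_bound_def)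
  then have "Lindelof_number X \<le>o p"
    by (rule Lindelof_number_least_same_type[THEN conjunct2, rule_format])
  then have "Lindelof_number X \<le>o \<nu>"
    by (rule ordLeq_ordIso_trans) (rule ordIso_symmetric[OF p])
  with n show False by contradiction
qed

end

theory Submission
  imports Defs
begin

text \<open>
  Every open neighbourhood of \<open>b\<close> in the pointwise topology contains all elements that finitely many
  ultrafilters \<open>Q b\<close> cannot tell apart from \<open>b\<close>. Let \<open>G\<close> witness that the algebra is Corson and close
  off to a subalgebra \<open>C\<close> of size less than \<open>\<kappa>\<close> that contains \<open>G \<inter> q\<close> for all \<open>b \<in> C\<close> and \<open>q \<in> Q b\<close>.
  Replacing the generators outside \<open>C\<close> by \<open>bot\<close> turns an arbitrary \<open>a\<close> into some \<open>c \<in> C\<close> that all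
  ultrafilters \<open>q\<close> with \<open>G \<inter> q \<subseteq> C\<close> fail to tell apart from \<open>a\<close>, those in \<open>Q c\<close> among them. So the
  members of the cover chosen for the elements of \<open>C\<close> already cover the algebra.
\<close>

section \<open>Ultrafilters and the pointwise topology\<close>

lemma Ult_bot: "q \<in> Ult \<Longrightarrow> bot \<notin> q"
  by (simp add: Ult_def proper_filter_def)

lemma Ult_inf_iff: "q \<in> Ult \<Longrightarrow> inf a b \<in> q \<longleftrightarrow> a \<in> q \<and> b \<in> q"
  by (simp add: Ult_def proper_filter_def) (meson inf.cobounded1 inf.cobounded2)

text \<open>By maximality: if \<open>a\<close> is not in \<open>q\<close>, the filter generated by
  \<open>q\<close> and \<open>a\<close> is improper, which puts some element of \<open>q\<close>
  below \<open>- a\<close>.\<close>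

lemma Ult_compl_iff:
  fixes a :: "'a::boolean_algebra"
  assumes "q \<in> Ult"
  shows "- a \<in> q \<longleftrightarrow> a \<notin> q"
proof
  assume "- a \<in> q"
  show "a \<notin> q"
  proof
    assume "a \<in> q"
    with \<open>- a \<in> q\<close> Ult_inf_iff[OF assms, of a "- a"] Ult_bot[OF assms] show False
      by simp
  qed
next
  assume a: "a \<notin> q"
  have q: "top \<in> q" "\<And>x y. x \<in> q \<Longrightarrow> y \<in> q \<Longrightarrow> inf x y \<in> q" "\<And>x y. x \<in> q \<Longrightarrow> x \<le> y \<Longrightarrow> y \<in> q"
    and max: "\<And>r. proper_filter r \<Longrightarrow> q \<subseteq> r \<Longrightarrow> r = q"
    using assms unfolding Ult_def proper_filter_def by auto
  \<comment> \<open>The filter generated by \<open>q\<close> and \<open>a\<close>; one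
    \<open>y\<close> suffices because \<open>q\<close> is closed under meets.\<close>
  define r where "r = {x. \<exists>y\<in>q. inf a y \<le> x}"
  have "q \<subseteq> r"
    by (auto simp: r_def intro: inf.cobounded2)
  moreover have "a \<in> r"
    using q(1) by (auto simp: r_def)
  ultimately have "\<not> proper_filter r"
    using max a by blast
  moreover have "top \<in> r"
    using q(1) by (auto simp: r_def)
  moreover have "inf x y \<in> r" if xy: "x \<in> r" "y \<in> r" for x y
  proof -
    obtain u v where uv: "u \<in> q" "v \<in> q" "inf a u \<le> x" "inf a v \<le> y"
      using xy by (auto simp: r_def)
    then have "inf a (inf u v) \<le> inf x y"
      using inf_mono[OF uv(3,4)] by (simp add: inf.left_commute inf.assoc)
    then show ?thesis
      using q(2) uv by (auto simp: r_def)
  qed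
  moreover have "y \<in> r" if "x \<in> r" "x \<le> y" for x y
    using that by (auto simp: r_def intro: order_trans)
  ultimately have "bot \<in> r"
    unfolding proper_filter_def by blast
  then obtain y where "y \<in> q" "inf a y \<le> bot"
    by (auto simp: r_def)
  then have "y \<le> - a"
    by (simp add: bot_unique inf_shunt compl_le_swap1)
  with \<open>y \<in> q\<close> q(3) show "- a \<in> q"
    by blast
qed

text \<open>Induction on the generation of \<open>U\<close>: a subbasic set needs at most one
  ultrafilter, an intersection the union of two finite sets, a union those of one member containing
  \<open>a\<close>. Asking for agreement on \<open>Q\<close> treats both kinds of subbasic sets
  alike.\<close>

lemma openin_pointwise_topology_finite_Ult:
  assumes "openin pointwise_topology U" "a \<in> U"
  shows "\<exists>Q. finite Q \<and> Q \<subseteq> Ult \<and> (\<forall>b. (\<forall>q\<in>Q. b \<in> q \<longleftrightarrow> a \<in> q) \<longrightarrow> b \<in> U)"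
proof -
  let ?P = "\<lambda>Q U. finite Q \<and> Q \<subseteq> Ult \<and> (\<forall>b. (\<forall>q\<in>Q. b \<in> q \<longleftrightarrow> a \<in> q) \<longrightarrow> b \<in> U)"
  have "generate_topology_on
     (insert UNIV ((\<lambda>q. {a. a \<in> q}) ` Ult \<union> (\<lambda>q. {a. a \<notin> q}) ` Ult)) U"
    using assms(1) by (simp add: pointwise_topology_def openin_topology_generated_by_iff)
  then have "a \<in> U \<longrightarrow> (\<exists>Q. ?P Q U)"
  proof induction
    case (Int U V)
    show ?case
    proof
      assume "a \<in> U \<inter> V"
      with Int.IH obtain Q R where "?P Q U" "?P R V"
        by (elim IntE) meson
      then have "?P (Q \<union> R) (U \<inter> V)"
        by auto
      then show "\<exists>Q. ?P Q (U \<inter> V)"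
        by blast
    qed
  next
    case (UN K)
    show ?case
    proof
      assume "a \<in> \<Union>K"
      then obtain U where U: "U \<in> K" "a \<in> U"
        by blast
      then obtain Q where "?P Q U"
        using UN.IH by meson
      then have "?P Q (\<Union>K)"
        using U(1) by auto
      then show "\<exists>Q. ?P Q (\<Union>K)"
        by blast
    qed
  next
    case (Basis s)
    then consider "s = UNIV" | q where "q \<in> Ult" "s = {a. a \<in> q} \<or> s = {a. a \<notin> q}"
      by auto
    then show ?case
    proof cases
      case 1
      then show ?thesis by (intro impI exI[of _ "{}"]) simp
    next
      case 2
      then show ?thesis by (intro impI exI[of _ "{q}"]) auto
    qed
  qed simp
  with assms(2) show ?thesis
    by (rule mp[rotated])
qed

section \<open>Small closed sets and approximation by their elements\<close>

lemma finite_ordLess_Cinfinite: "Cinfinite r \<Longrightarrow> finite X \<Longrightarrow> |X| <o r"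
  by (rule Cfinite_ordLess_Cinfinite) (simp_all add: cfinite_def Field_card_of card_of_card_order_on)

text \<open>Iterate \<open>T\<close> from \<open>{c}\<close> in countably many steps. Regularity
  keeps every stage small, and uncountability of \<open>\<kappa>\<close> then keeps their union
  small.\<close>

lemma exists_closed_set_ordLess:
  fixes T :: "'a \<Rightarrow> 'a \<Rightarrow> 'a set"
  assumes "Card_order \<kappa>" "natLeq <o \<kappa>" "regularCard \<kappa>"
    and T: "\<And>a b. |T a b| <o \<kappa>"
  obtains C where "c \<in> C" "|C| <o \<kappa>" "\<And>a b. a \<in> C \<Longrightarrow> b \<in> C \<Longrightarrow> T a b \<subseteq> C"
proof -
  have inf: "Cinfinite \<kappa>"
    using assms(1,2) by (metis cinfinite_mono natLeq_cinfinite ordLess_imp_ordLeq)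
  \<comment> \<open>The index type stays general: indices are elements of a stage first, stage
    numbers later.\<close>
  have UN: "|\<Union>i\<in>I. A i| <o \<kappa>" if "|I| <o \<kappa>" "\<And>i. i \<in> I \<Longrightarrow> |A i| <o \<kappa>"
    for I :: "'i set" and A :: "'i \<Rightarrow> 'a set"
    using regularCard_UNION_bound[OF inf assms(3)] that by blast
  define D where "D = rec_nat {c} (\<lambda>_ X. X \<union> (\<Union>a\<in>X. \<Union>b\<in>X. T a b))"
  have D0: "D 0 = {c}" and DS: "D (Suc n) = D n \<union> (\<Union>a\<in>D n. \<Union>b\<in>D n. T a b)" for n
    by (simp_all add: D_def)
  have infk: "infinite (Field \<kappa>)"
    using inf by (simp add: cinfinite_def)
  have card: "|D n| <o \<kappa>" for n
  proof (induction n)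
    case 0
    show ?case by (simp add: D0 finite_ordLess_Cinfinite[OF inf])
  next
    case (Suc n)
    have "|\<Union>a\<in>D n. \<Union>b\<in>D n. T a b| <o \<kappa>"
      by (intro UN Suc T)
    then show ?case
      unfolding DS by (rule card_of_Un_ordLess_infinite_Field[OF infk assms(1) Suc])
  qed
  have mono: "D m \<subseteq> D n" if "m \<le> n" for m n
    using that by (rule lift_Suc_mono_le[of D, rotated]) (auto simp: DS)
  show thesis
  proof (rule that)
    show "c \<in> (\<Union>n. D n)"
      using D0 by auto
    show "|\<Union>n. D n| <o \<kappa>"
      using card by (intro UN ordIso_ordLess_trans[OF card_of_nat assms(2)]) auto
    fix a b assume "a \<in> (\<Union>n. D n)" "b \<in> (\<Union>n. D n)"
    then obtain m n where "a \<in> D m" "b \<in> D n"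
      by auto
    then have "a \<in> D (max m n)" "b \<in> D (max m n)"
      using mono by (meson max.cobounded1 max.cobounded2 subsetD)+
    then have "T a b \<subseteq> D (Suc (max m n))"
      by (auto simp: DS)
    then show "T a b \<subseteq> (\<Union>n. D n)"
      by blast
  qed
qed

text \<open>The elements \<open>a\<close> that have such a \<open>c\<close> form a subalgebra
  containing \<open>G\<close>, because \<open>C\<close> is closed under the corresponding
  operations.\<close>

lemma generated_Ult_indistinguishable:
  fixes a :: "'a::boolean_algebra"
  assumes "generates_boolean_algebra G"
    and "bot \<in> C" "\<And>a b. a \<in> C \<Longrightarrow> b \<in> C \<Longrightarrow> inf a b \<in> C" "\<And>a. a \<in> C \<Longrightarrow> - a \<in> C"
  shows "\<exists>c\<in>C. \<forall>q\<in>Ult. G \<inter> q \<subseteq> C \<longrightarrow> (a \<in> q \<longleftrightarrow> c \<in> q)"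
proof -
  define S where "S = {a. \<exists>c\<in>C. \<forall>q\<in>Ult. G \<inter> q \<subseteq> C \<longrightarrow> (a \<in> q \<longleftrightarrow> c \<in> q)}"
  have SI: "a \<in> S" if "c \<in> C" "\<And>q. q \<in> Ult \<Longrightarrow> G \<inter> q \<subseteq> C \<Longrightarrow> a \<in> q \<longleftrightarrow> c \<in> q" for a c
    using that by (auto simp: S_def)
  have "G \<subseteq> S"
  proof
    fix g assume g: "g \<in> G"
    show "g \<in> S"
    proof (cases "g \<in> C")
      case True
      then show ?thesis by (auto intro: SI)
    next
      \<comment> \<open>An ultrafilter \<open>q\<close> containing \<open>g\<close> would violate
        \<open>G \<inter> q \<subseteq> C\<close>, so \<open>bot\<close> replaces
        \<open>g\<close>.\<close>
      case False
      with g show ?thesis by (intro SI[OF assms(2)]) (auto simp: Ult_bot)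
    qed
  qed
  moreover have "boolean_subalgebra S"
  proof -
    have bot: "bot \<in> S"
      by (rule SI[OF assms(2)]) simp
    have compl: "- x \<in> S" if x: "x \<in> S" for x
    proof -
      obtain c where "c \<in> C" "\<forall>q\<in>Ult. G \<inter> q \<subseteq> C \<longrightarrow> (x \<in> q \<longleftrightarrow> c \<in> q)"
        using x by (auto simp: S_def)
      then show ?thesis
        by (intro SI[of "- c"]) (simp_all add: assms(4) Ult_compl_iff)
    qed
    have inf: "inf x y \<in> S" if xy: "x \<in> S" "y \<in> S" for x y
    proof -
      obtain c d where "c \<in> C" "\<forall>q\<in>Ult. G \<inter> q \<subseteq> C \<longrightarrow> (x \<in> q \<longleftrightarrow> c \<in> q)"
        and "d \<in> C" "\<forall>q\<in>Ult. G \<inter> q \<subseteq> C \<longrightarrow> (y \<in> q \<longleftrightarrow> d \<in> q)"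
        using xy by (auto simp: S_def)
      then show ?thesis
        by (intro SI[of "inf c d"]) (simp_all add: assms(3) Ult_inf_iff)
    qed
    \<comment> \<open>De Morgan reduces joins to meets and complements.\<close>
    have "sup x y \<in> S" if "x \<in> S" "y \<in> S" for x y
      using compl[OF inf[OF compl[OF that(1)] compl[OF that(2)]]] by simp
    moreover have "top \<in> S"
      using compl[OF bot] by simp
    ultimately show ?thesis
      using bot compl inf by (simp add: boolean_subalgebra_def)
  qed
  ultimately have "boolean_subalgebra hull G \<subseteq> S"
    by (rule hull_minimal)
  then have "a \<in> S"
    using assms(1) by (auto simp: generates_boolean_algebra_def)
  then show ?thesis
    by (simp add: S_def)
qed

section \<open>The Lindelof property and the Lindelof number\<close>

lemma Corson_algebra_card_Lindelof:
  fixes \<kappa> :: "'k rel"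
  assumes "Card_order \<kappa>" and "natLeq <o \<kappa>" and "regularCard \<kappa>"
    and "Corson_algebra \<kappa> TYPE('a::boolean_algebra)"
  shows "card_Lindelof_space \<kappa> (pointwise_topology :: 'a topology)"
  unfolding card_Lindelof_space_def topspace_pointwise_topology
proof (intro allI impI)
  fix \<U> :: "'a set set"
  assume \<U>: "(\<forall>U\<in>\<U>. openin pointwise_topology U) \<and> \<Union>\<U> = UNIV"
  obtain G :: "'a set" where G: "generates_boolean_algebra G" "\<And>p. p \<in> Ult \<Longrightarrow> |G \<inter> p| <o \<kappa>"
    using assms(4) by (auto simp: Corson_algebra_def)
  have inf: "Cinfinite \<kappa>"
    using assms(1,2) by (metis cinfinite_mono natLeq_cinfinite ordLess_imp_ordLeq)
  have infk: "infinite (Field \<kappa>)"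
    using inf by (simp add: cinfinite_def)
  have "\<forall>a. \<exists>U. U \<in> \<U> \<and> a \<in> U"
    using conjunct2[OF \<U>] by (metis UNIV_I UnionE)
  then obtain U where U: "\<And>a. U a \<in> \<U>" "\<And>a. a \<in> U a"
    by metis
  have "\<forall>a. \<exists>Q. finite Q \<and> Q \<subseteq> Ult \<and> (\<forall>b. (\<forall>q\<in>Q. b \<in> q \<longleftrightarrow> a \<in> q) \<longrightarrow> b \<in> U a)"
    using conjunct1[OF \<U>] U by (intro allI openin_pointwise_topology_finite_Ult) simp_all
  then obtain Q where Q_all:
    "\<forall>a. finite (Q a) \<and> Q a \<subseteq> Ult \<and> (\<forall>b. (\<forall>q\<in>Q a. b \<in> q \<longleftrightarrow> a \<in> q) \<longrightarrow> b \<in> U a)"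
    by (rule choice[THEN exE])
  then have Q: "\<And>a. finite (Q a)" "\<And>a. Q a \<subseteq> Ult"
    by simp_all
  have UQ: "b \<in> U a" if "\<And>q. q \<in> Q a \<Longrightarrow> b \<in> q \<longleftrightarrow> a \<in> q" for a b
    using Q_all that by simp
  have UN: "|\<Union>q\<in>Q a. G \<inter> q| <o \<kappa>" for a
    using regularCard_UNION_bound[OF inf assms(3) finite_ordLess_Cinfinite[OF inf Q(1)]] G(2) Q(2) by blast
  \<comment> \<open>One binary operation combines all closure requirements on \<open>C\<close>; only
    the meet uses \<open>b\<close>.\<close>
  define T where "T a b = {inf a b, - a} \<union> (\<Union>q\<in>Q a. G \<inter> q)" for a b
  have T: "|T a b| <o \<kappa>" for a b
    unfolding T_def by (intro card_of_Un_ordLess_infinite_Field[OF infk assms(1)] finite_ordLess_Cinfinite[OF inf] UN) simp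
  obtain C
    where C: "bot \<in> C" "|C| <o \<kappa>" and closed: "\<And>a b. a \<in> C \<Longrightarrow> b \<in> C \<Longrightarrow> T a b \<subseteq> C"
    by (rule exists_closed_set_ordLess[OF assms(1-3), of T bot]) (simp_all add: T)
  have "a \<in> \<Union> (U ` C)" for a
  proof -
    have Cinf: "inf x y \<in> C" if "x \<in> C" "y \<in> C" for x y
      using closed[OF that] by (simp add: T_def)
    have Ccompl: "- x \<in> C" if "x \<in> C" for x
      using closed[OF that that] by (simp add: T_def)
    have "\<exists>c\<in>C. \<forall>q\<in>Ult. G \<inter> q \<subseteq> C \<longrightarrow> (a \<in> q \<longleftrightarrow> c \<in> q)"
      by (rule generated_Ult_indistinguishable[OF G(1) C(1)]) (simp_all add: Cinf Ccompl)
    then obtain c where c: "c \<in> C" "\<forall>q\<in>Ult. G \<inter> q \<subseteq> C \<longrightarrow> (a \<in> q \<longleftrightarrow> c \<in> q)"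
      by (rule bexE)
    \<comment> \<open>Since \<open>c\<close> is in \<open>C\<close>, closure under
      \<open>T c c\<close> makes each \<open>q\<close> in \<open>Q c\<close> one of the ultrafilters
      that cannot separate \<open>a\<close> from \<open>c\<close>.\<close>
    have "a \<in> q \<longleftrightarrow> c \<in> q" if "q \<in> Q c" for q
    proof -
      have "q \<in> Ult"
        using that Q(2) by (rule subsetD[rotated])
      moreover have "G \<inter> q \<subseteq> C"
        using that closed[OF c(1) c(1)] by (auto simp: T_def)
      ultimately show ?thesis
        using c(2) by simp
    qed
    then have "a \<in> U c"
      by (rule UQ)
    with c(1) show ?thesis by blast
  qed
  moreover have "|U ` C| <o \<kappa>"
    using card_of_image C(2) by (rule ordLeq_ordLess_trans)
  ultimately show "\<exists>\<V>. |\<V>| <o \<kappa> \<and> \<V> \<subseteq> \<U> \<and> \<Union>\<V> = UNIV"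
    using U(1) by (intro exI[of _ "U ` C"]) auto
qed

text \<open>Being smaller than the successor of \<open>\<mu>\<close> means having size at most
  \<open>\<mu>\<close>; for the same reason uncountability of \<open>\<kappa>\<close> makes
  \<open>\<mu>\<close> infinite.\<close>

lemma card_Lindelof_space_cardSuc:
  assumes "card_Lindelof_space \<kappa> X" "natLeq <o \<kappa>" "Card_order \<mu>" "\<kappa> =o cardSuc \<mu>"
  shows "Lindelof_bound X \<mu>"
proof -
  have lt: "|V| <o \<kappa> \<longleftrightarrow> |V| \<le>o \<mu>" for V :: "'x set"
    using cardSuc_ordLeq_ordLess[OF assms(3) card_of_Card_order] assms(4)
    by (meson ordIso_symmetric ordLess_ordIso_trans)
  have "natLeq <o cardSuc \<mu>"
    using assms(2,4) by (rule ordLess_ordIso_trans)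
  then have "natLeq \<le>o \<mu>"
    using cardSuc_ordLeq_ordLess[OF assms(3) natLeq_Card_order] by simp
  then have "cinfinite \<mu>"
    using cinfinite_mono natLeq_cinfinite by blast
  with assms(1,3) show ?thesis
    by (simp add: Lindelof_bound_def card_Lindelof_space_def lt)
qed

theorem theorem4p1:
  fixes \<kappa> :: "'k rel"
  assumes "Card_order \<kappa>" and "natLeq <o \<kappa>" and "regularCard \<kappa>"
    and "Corson_algebra \<kappa> TYPE('a::boolean_algebra)"
  shows "card_Lindelof_space \<kappa> (pointwise_topology :: 'a topology) \<and>
    (\<forall>\<mu>::'l rel. Card_order \<mu> \<and> \<kappa> =o cardSuc \<mu>
       \<longrightarrow> Lindelof_number (pointwise_topology :: 'a topology) \<le>o \<mu>)"
  using Corson_algebra_card_Lindelof[OF assms] assms(2)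
  by (auto intro: Lindelof_number_least card_Lindelof_space_cardSuc)

end
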